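(* Let $(X,d)$ be a compact metric space, let $f\colon X\to X$ be a homeomorphism, and let $\Lambda$ be a closed $f$-invariant subset of $X$. Suppose that (i) $X$ is connected and locally connected; (ii) ${\rm int}[\Lambda]\cap{\rm int}[CR(f)]\ne\emptyset$ (this is the case in particular when $\Lambda\subset CR(f)$ and ${\rm int}[\Lambda]\ne\emptyset$); (iii) $f$ has shadowing and L-shadowing on $B_b(\Lambda)$ for some $b>0$. Then $X=\Lambda$ and $f$ is a mixing homeomorphism.
   Context: A subset $S\subset X$ is $f$-invariant if $f(S)\subset S$. ${\rm int}[S]$ is the interior of $S$. For $r>0$, $B_r(S)=\{x\in X: d(x,S)\le r\}$, where $d(x,S)=\inf_{y\in S}d(x,y)$. $X$ is locally connected if for any $x\in X$ and any open $U\ni x$ there is an open connected $V$ with $x\in V\subset U$. For a continuous map $f\colon X\to X$ and $\delta>0$, a $\delta$-chain of $f$ is a finite sequence $(x_i)_{i=0}^k$ in $X$, $k\ge1$, with $d(f(x_i),x_{i+1})\le\delta$ for $0\le i\le k-1$. Write $x\rightarrow y$ if for every $\delta>0$ there is a $\delta$-chain $(x_i)_{i=0}^k$ of $f$ with $x_0=x$, $x_k=y$. The chain recurrent set is $CR(f)=\{x\in X: x\rightarrow x\}$. $f$ has shadowing on $S\subset X$ if for any $\epsilon>0$ there is $\delta>0$ such that for every $\delta$-chain $(x_i)_{i=0}^k$ of $f$ with all $x_i\in S$ there is $x\in X$ with $\sup_{0\le i\le k}d(x_i,f^i(x))\le\epsilon$. For a homeomorphism $f$, a $\delta$-limit-pseudo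 orbit of $f$ is a bi-infinite sequence $(x_i)_{i\in\mathbb{Z}}$ in $X$ with $\sup_{i\in\mathbb{Z}}d(f(x_i),x_{i+1})\le\delta$ and $d(f(x_i),x_{i+1})\to0$ as $i\to-\infty$ and as $i\to+\infty$. $f$ has L-shadowing on $S\subset X$ if for any $\epsilon>0$ there is $\delta>0$ such that for every $\delta$-limit-pseudo orbit $(x_i)_{i\in\mathbb{Z}}$ of $f$ with all $x_i\in S$ there is $x\in X$ with $\sup_{i\in\mathbb{Z}}d(x_i,f^i(x))\le\epsilon$ and $d(x_i,f^i(x))\to0$ as $i\to-\infty$ and as $i\to+\infty$. $f$ is mixing if for any nonempty open $U,V\subset X$ there is $j\ge0$ such that $f^i(U)\cap V\ne\emptyset$ for all $i\ge j$. *)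

theory Defs
  imports "HOL-Analysis.Analysis"
begin

definition invariant_set :: "('a \<Rightarrow> 'a) \<Rightarrow> 'a set \<Rightarrow> bool" where
  "invariant_set f S \<longleftrightarrow> f ` S \<subseteq> S"

text \<open>The closed neighbourhood of a nonempty set. The library convention is
  \<^term>\<open>infdist x {} = 0\<close>, so for the empty set this is the whole space rather than
  the empty set.\<close>

definition closed_nbhd :: "real \<Rightarrow> 'a::metric_space set \<Rightarrow> 'a set" where
  "closed_nbhd r S = {x. infdist x S \<le> r}"

text \<open>A finite sequence with indices \<open>0, \<dots>, k\<close> is encoded by a function on \<^typ>\<open>nat\<close>
  whose values beyond \<open>k\<close> are irrelevant.\<close>

definition delta_chain :: "('a::metric_space \<Rightarrow> 'a) \<Rightarrow> real \<Rightarrow> nat \<Rightarrow> (nat \<Rightarrow> 'a) \<Rightarrow> bool" where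
  "delta_chain f \<delta> k x \<longleftrightarrow> k \<ge> 1 \<and> (\<forall>i<k. dist (f (x i)) (x (Suc i)) \<le> \<delta>)"

definition chain_to :: "('a::metric_space \<Rightarrow> 'a) \<Rightarrow> 'a \<Rightarrow> 'a \<Rightarrow> bool" where
  "chain_to f x y \<longleftrightarrow> (\<forall>\<delta>>0. \<exists>k c. delta_chain f \<delta> k c \<and> c 0 = x \<and> c k = y)"

definition chain_recurrent :: "('a::metric_space \<Rightarrow> 'a) \<Rightarrow> 'a set" where
  "chain_recurrent f = {x. chain_to f x x}"

text \<open>The conditions of the form \<open>sup \<le> \<epsilon>\<close> on distances are expressed by bounding every term.\<close>

definition shadowing_on :: "('a::metric_space \<Rightarrow> 'a) \<Rightarrow> 'a set \<Rightarrow> bool" where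
  "shadowing_on f S \<longleftrightarrow>
     (\<forall>\<epsilon>>0. \<exists>\<delta>>0. \<forall>k x. delta_chain f \<delta> k x \<and> (\<forall>i\<le>k. x i \<in> S) \<longrightarrow>
        (\<exists>z. \<forall>i\<le>k. dist (x i) ((f ^^ i) z) \<le> \<epsilon>))"

text \<open>Meaningful for bijective \<open>f\<close> only.\<close>

definition int_iter :: "('a \<Rightarrow> 'a) \<Rightarrow> int \<Rightarrow> 'a \<Rightarrow> 'a" where
  "int_iter f i = (if i \<ge> 0 then f ^^ nat i else inv f ^^ nat (- i))"

definition limit_pseudo_orbit :: "('a::metric_space \<Rightarrow> 'a) \<Rightarrow> real \<Rightarrow> (int \<Rightarrow> 'a) \<Rightarrow> bool" where
  "limit_pseudo_orbit f \<delta> x \<longleftrightarrow>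
     (\<forall>i. dist (f (x i)) (x (i + 1)) \<le> \<delta>) \<and>
     ((\<lambda>i. dist (f (x i)) (x (i + 1))) \<longlongrightarrow> 0) at_bot \<and>
     ((\<lambda>i. dist (f (x i)) (x (i + 1))) \<longlongrightarrow> 0) at_top"

definition L_shadowing_on :: "('a::metric_space \<Rightarrow> 'a) \<Rightarrow> 'a set \<Rightarrow> bool" where
  "L_shadowing_on f S \<longleftrightarrow>
     (\<forall>\<epsilon>>0. \<exists>\<delta>>0. \<forall>x. limit_pseudo_orbit f \<delta> x \<and> (\<forall>i. x i \<in> S) \<longrightarrow>
        (\<exists>z. (\<forall>i. dist (x i) (int_iter f i z) \<le> \<epsilon>) \<and>
             ((\<lambda>i. dist (x i) (int_iter f i z)) \<longlongrightarrow> 0) at_bot \<and>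
             ((\<lambda>i. dist (x i) (int_iter f i z)) \<longlongrightarrow> 0) at_top))"

definition mixing :: "('a::topological_space \<Rightarrow> 'a) \<Rightarrow> bool" where
  "mixing f \<longleftrightarrow>
     (\<forall>U V. open U \<and> U \<noteq> {} \<and> open V \<and> V \<noteq> {} \<longrightarrow>
        (\<exists>j. \<forall>i\<ge>j. (f ^^ i) ` U \<inter> V \<noteq> {}))"

text \<open>The library's \<^term>\<open>locally connected\<close> asks for connected, not necessarily open,
  neighbourhoods; on the whole space this amounts to a base of open connected sets.\<close>

lemma locally_connected_UNIV_iff:
  "locally connected (UNIV :: 'a::topological_space set) \<longleftrightarrow>
     (\<forall>x (U::'a set). open U \<and> x \<in> U \<longrightarrow> (\<exists>V. open V \<and> connected V \<and> x \<in> V \<and> V \<subseteq> U))"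
  unfolding locally_connected by auto

lemma interior_Int_chain_recurrent_nonempty:
  assumes "S \<subseteq> chain_recurrent f" "interior S \<noteq> {}"
  shows "interior S \<inter> interior (chain_recurrent f) \<noteq> {}"
  using assms interior_mono by blast

end

theory Submission
  imports Defs
begin

text \<open>
  Let \<open>p\<close> lie in the interior of both \<open>\<Lambda>\<close> and the chain recurrent set, let \<open>U\<close> be a connected
  neighbourhood of \<open>p\<close> there, and let \<open>C\<close> be the set of points reachable from \<open>p\<close> by
  \<open>\<delta>\<close>-chains for every \<open>\<delta>\<close>. By shadowing, chains from \<open>p\<close> follow true orbits starting in
  \<open>U\<close>; hence they stay near \<open>\<Lambda>\<close>, \<open>C\<close> is a single chain class containing \<open>U\<close>, and \<open>C\<close> is
  Lyapunov stable. L-shadowing, applied to a backward orbit in \<open>C\<close> followed by the forward orbit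
  of a point \<open>w\<close> close to \<open>C\<close>, shows that \<open>w\<close> is attracted by \<open>C\<close>. The orbit of \<open>w\<close>, continued
  by an arbitrarily small jump into \<open>C\<close> and a chain back to \<open>p\<close>, is then shadowed by an orbit that
  ends in \<open>U\<close> and so lies in \<open>C\<close>; thus \<open>w\<close> is a limit of points of \<open>C\<close>. So \<open>C\<close> is
  open and closed, i.e. the whole space, and connectedness upgrades chain transitivity to chain
  mixing, which shadowing turns into mixing.
\<close>

section \<open>Strict chains as a relation, and perturbation of their endpoints\<close>

text \<open>Chains become paths of a relation, so powers and transitive closure apply. The strict
  bound leaves slack in every step, so membership survives small changes of the endpoints when
  \<open>f\<close> is continuous.\<close>

definition chain_step :: "('a::metric_space \<Rightarrow> 'a) \<Rightarrow> real \<Rightarrow> ('a \<times> 'a) set" where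
  "chain_step f \<delta> = {(x, y). dist (f x) y < \<delta>}"

lemma chain_step_iff [simp]: "(x, y) \<in> chain_step f \<delta> \<longleftrightarrow> dist (f x) y < \<delta>"
  by (simp add: chain_step_def)

lemma chain_step_mono: "\<delta> \<le> \<delta>' \<Longrightarrow> chain_step f \<delta> \<subseteq> chain_step f \<delta>'"
  by (auto simp: chain_step_def)

lemma delta_chain_of_relpow:
  assumes "(x, y) \<in> chain_step f \<delta> ^^ k" "k \<ge> 1"
  obtains c where "delta_chain f \<delta> k c" "c 0 = x" "c k = y"
    "\<And>i. i < k \<Longrightarrow> (c i, c (Suc i)) \<in> chain_step f \<delta>"
proof -
  obtain c where "c 0 = x" "c k = y" "\<forall>i<k. (c i, c (Suc i)) \<in> chain_step f \<delta>"
    using assms by (auto simp only: relpow_fun_conv)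
  then show thesis
    using assms by (intro that[of c]) (auto simp: delta_chain_def intro: less_imp_le)
qed

text \<open>Weak and strict bounds agree once all \<open>\<delta>\<close> are quantified: a weak
  chain for \<open>\<delta> / 2\<close> is a strict one for \<open>\<delta>\<close>.\<close>

lemma chain_to_iff: "chain_to f x y \<longleftrightarrow> (\<forall>\<delta>>0. (x, y) \<in> (chain_step f \<delta>)\<^sup>+)"
proof
  assume *: "chain_to f x y"
  show "\<forall>\<delta>>0. (x, y) \<in> (chain_step f \<delta>)\<^sup>+"
  proof (intro allI impI)
    fix \<delta> :: real assume "\<delta> > 0"
    with * obtain k c where "delta_chain f (\<delta> / 2) k c" "c 0 = x" "c k = y"
      unfolding chain_to_def by (meson half_gt_zero)
    with \<open>\<delta> > 0\<close> have "k > 0" "(x, y) \<in> chain_step f \<delta> ^^ k"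
      by (force simp: delta_chain_def relpow_fun_conv)+
    then show "(x, y) \<in> (chain_step f \<delta>)\<^sup>+"
      by (auto simp: trancl_power)
  qed
next
  assume *: "\<forall>\<delta>>0. (x, y) \<in> (chain_step f \<delta>)\<^sup>+"
  show "chain_to f x y"
    unfolding chain_to_def
  proof (intro allI impI)
    fix \<delta> :: real assume "\<delta> > 0"
    with * obtain k where "k > 0" "(x, y) \<in> chain_step f \<delta> ^^ k"
      by (auto simp: trancl_power)
    then show "\<exists>k c. delta_chain f \<delta> k c \<and> c 0 = x \<and> c k = y"
      by (metis delta_chain_of_relpow Suc_leI One_nat_def)
  qed
qed

lemma chain_to_trans: "chain_to f x y \<Longrightarrow> chain_to f y z \<Longrightarrow> chain_to f x z"
  by (meson chain_to_iff trancl_trans)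

lemma chain_to_image: "chain_to f x (f x)"
  by (auto simp: chain_to_iff)

lemma trancl_chain_step_end:
  assumes "(x, y) \<in> (chain_step f \<delta>)\<^sup>+" "dist y y' < \<eta>" "\<delta> + \<eta> \<le> \<epsilon>"
  shows "(x, y') \<in> (chain_step f \<epsilon>)\<^sup>+"
proof -
  obtain u where u: "(x, u) \<in> (chain_step f \<delta>)\<^sup>*" "dist (f u) y < \<delta>"
    using assms(1) by (auto dest: tranclD2)
  have "dist (f u) y' < \<epsilon>"
    using dist_triangle[of "f u" y' y] u assms by linarith
  moreover have "\<delta> \<le> \<epsilon>"
    using assms(2,3) zero_le_dist[of y y'] by linarith
  then have "(x, u) \<in> (chain_step f \<epsilon>)\<^sup>*"
    using u(1) rtrancl_mono[OF chain_step_mono] by blast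
  ultimately show ?thesis
    by (auto intro: rtrancl_into_trancl1)
qed

text \<open>Only the first step changes, and the starting point enters it only through its image;
  hence the hypothesis on \<open>f x\<close> and \<open>f x'\<close>.\<close>

lemma trancl_chain_step_start:
  assumes "(x, y) \<in> (chain_step f \<delta>)\<^sup>+" "dist (f x) (f x') < \<eta>" "\<delta> + \<eta> \<le> \<epsilon>"
  shows "(x', y) \<in> (chain_step f \<epsilon>)\<^sup>+"
proof -
  obtain u where u: "(u, y) \<in> (chain_step f \<delta>)\<^sup>*" "dist (f x) u < \<delta>"
    using assms(1) by (auto dest: tranclD)
  have "dist (f x') u < \<epsilon>"
    using dist_triangle[of "f x'" u "f x"] u assms by (simp add: dist_commute)
  moreover have "\<delta> \<le> \<epsilon>"
    using assms(2,3) zero_le_dist[of "f x" "f x'"] by linarith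
  then have "(u, y) \<in> (chain_step f \<epsilon>)\<^sup>*"
    using u(1) rtrancl_mono[OF chain_step_mono] by blast
  ultimately show ?thesis
    by (auto intro: rtrancl_into_trancl2)
qed

lemma rtrancl_chain_step_funpow: "\<delta> > 0 \<Longrightarrow> (x, (f ^^ n) x) \<in> (chain_step f \<delta>)\<^sup>*"
  by (induction n) (auto intro: rtrancl_into_rtrancl)

text \<open>A cycle at a recurrent \<open>u\<close> first visits some \<open>v\<close> near
  \<open>f u\<close> and then returns to \<open>u\<close>. By continuity the return can start at
  \<open>f u\<close> instead, and this iterates.\<close>

lemma chain_to_funpow_left:
  assumes f: "continuous_on UNIV f" and z: "chain_to f z z"
  shows "chain_to f ((f ^^ k) z) z"
proof -
  have step: "chain_to f (f u) u" if u: "chain_to f u u" for u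
    unfolding chain_to_iff
  proof (intro allI impI)
    fix \<delta> :: real assume "\<delta> > 0"
    then obtain \<eta> where \<eta>: "\<eta> > 0" "\<And>v. dist v (f u) < \<eta> \<Longrightarrow> dist (f v) (f (f u)) < \<delta> / 2"
      using f unfolding continuous_on_iff by (metis UNIV_I half_gt_zero)
    define \<gamma> where "\<gamma> = min \<eta> (\<delta> / 2)"
    have cyc: "(u, u) \<in> (chain_step f \<gamma>)\<^sup>+"
      using u \<eta> \<open>\<delta> > 0\<close> by (simp add: chain_to_iff \<gamma>_def)
    then obtain v where v: "dist (f u) v < \<gamma>" "(v, u) \<in> (chain_step f \<gamma>)\<^sup>*"
      by (auto dest: tranclD)
    \<comment> \<open>The cycle may have length one, with \<open>v = u\<close>; running it once more
      guarantees a first step to perturb.\<close>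
    with cyc have "(v, u) \<in> (chain_step f \<gamma>)\<^sup>+"
      by auto
    moreover have "dist (f v) (f (f u)) < \<delta> / 2"
      using v \<eta> by (simp add: \<gamma>_def dist_commute)
    ultimately show "(f u, u) \<in> (chain_step f \<delta>)\<^sup>+"
      by (rule trancl_chain_step_start) (simp add: \<gamma>_def)
  qed
  show ?thesis
  proof (induction k)
    case (Suc k)
    have "chain_to f z ((f ^^ k) z)"
      using z rtrancl_chain_step_funpow[of _ z k f]
      by (meson chain_to_iff trancl_rtrancl_trancl)
    with Suc have "chain_to f ((f ^^ k) z) ((f ^^ k) z)"
      by (metis chain_to_trans)
    from chain_to_trans[OF step[OF this] Suc] show ?case
      by simp
  qed (simp add: z)
qed

text \<open>For fixed \<open>\<delta>\<close>, mutual reachability is an equivalence on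
  \<open>S\<close>. Its classes are relatively open, since either end of a cycle at \<open>u\<close>
  can be moved slightly; connectedness leaves a single class.\<close>

lemma chain_to_connected:
  assumes f: "continuous_on UNIV f" and S: "connected S" "S \<subseteq> chain_recurrent f"
    and "x \<in> S" "y \<in> S"
  shows "chain_to f x y"
  unfolding chain_to_iff
proof (intro allI impI)
  fix \<delta> :: real assume \<delta>: "\<delta> > 0"
  define Q where "Q u v \<longleftrightarrow> (u, v) \<in> (chain_step f \<delta>)\<^sup>+ \<and> (v, u) \<in> (chain_step f \<delta>)\<^sup>+" for u v
  have "Q x y"
  proof (rule connected_equivalence_relation[OF S(1)])
    show "\<And>u v. Q u v \<Longrightarrow> Q v u" "\<And>u v w. Q u v \<Longrightarrow> Q v w \<Longrightarrow> Q u w"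
      unfolding Q_def by (auto intro: trancl_trans)
    fix u assume "u \<in> S"
    then have cyc: "(u, u) \<in> (chain_step f (\<delta> / 2))\<^sup>+"
      using S \<delta> by (auto simp: chain_recurrent_def chain_to_iff)
    obtain \<eta> where \<eta>: "\<eta> > 0" "\<And>v. dist v u < \<eta> \<Longrightarrow> dist (f v) (f u) < \<delta> / 2"
      using f \<delta> unfolding continuous_on_iff by (metis UNIV_I half_gt_zero)
    have "Q u v" if "v \<in> ball u (min \<eta> (\<delta> / 2))" for v
      unfolding Q_def using that \<eta>(2)[of v]
      by (auto simp: dist_commute
          intro!: trancl_chain_step_end[OF cyc, of v "\<delta> / 2"] trancl_chain_step_start[OF cyc, of v "\<delta> / 2"])
    then show "\<exists>T. openin (top_of_set S) T \<and> u \<in> T \<and> (\<forall>v\<in>T. Q u v)"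
      using \<open>u \<in> S\<close> \<eta>(1) \<delta> by (intro exI[of _ "S \<inter> ball u (min \<eta> (\<delta> / 2))"]) auto
  qed (use assms in auto)
  then show "(x, y) \<in> (chain_step f \<delta>)\<^sup>+"
    by (simp add: Q_def)
qed

lemma closed_chain_to: "closed {y. chain_to f x y}"
proof -
  have "chain_to f x y" if y: "\<And>e. e > 0 \<Longrightarrow> \<exists>y'. chain_to f x y' \<and> dist y' y < e" for y
    unfolding chain_to_iff
  proof (intro allI impI)
    fix \<delta> :: real assume "\<delta> > 0"
    with y[of "\<delta> / 2"] obtain y' where "chain_to f x y'" "dist y' y < \<delta> / 2"
      by auto
    then show "(x, y) \<in> (chain_step f \<delta>)\<^sup>+"
      using trancl_chain_step_end[of x y' f "\<delta> / 2" y "\<delta> / 2" \<delta>] \<open>\<delta> > 0\<close> by (auto simp: chain_to_iff)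
  qed
  then show ?thesis
    by (simp flip: closure_subset_eq add: subset_iff closure_approachable)
qed

subsection \<open>From chain transitivity to mixing\<close>

text \<open>Division gives \<open>N = q a + r = (q - r) a + r (a + 1)\<close>, and
  \<open>N \<ge> a * a\<close> forces \<open>r < a \<le> q\<close>. The positive coefficient
  \<open>q - r\<close> matters because \<open>0\<close> need not belong to \<open>S\<close>.\<close>

lemma semigroup_consecutive_cofinite:
  fixes S :: "nat set"
  assumes add: "\<And>m n. m \<in> S \<Longrightarrow> n \<in> S \<Longrightarrow> m + n \<in> S"
    and a: "a > 0" "a \<in> S" "Suc a \<in> S" and N: "N \<ge> a * a"
  shows "N \<in> S"
proof -
  have mult: "Suc k * s \<in> S" if "s \<in> S" for k s
    by (induction k) (use that add in auto)
  define q r where "q = N div a" and "r = N mod a"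
  have "r < a" "a \<le> q"
    using a N by (auto simp: q_def r_def less_eq_div_iff_mult_less_eq)
  have "N = q * a + r"
    by (simp add: q_def r_def)
  also have "\<dots> = (q - r) * a + r * Suc a"
    using \<open>r < a\<close> \<open>a \<le> q\<close> by (simp add: diff_mult_distrib)
  finally have *: "N = (q - r) * a + r * Suc a" .
  obtain k where k: "q - r = Suc k"
    using \<open>r < a\<close> \<open>a \<le> q\<close> by (metis Suc_diff_Suc less_le_trans)
  have ka: "(q - r) * a \<in> S"
    using mult[OF a(2)] k by metis
  show ?thesis
  proof (cases r)
    case 0
    with * ka show ?thesis by simp
  next
    case (Suc l)
    with mult[OF a(3)] have "r * Suc a \<in> S" by metis
    with * ka add show ?thesis by metis
  qed
qed

text \<open>The set \<open>A\<close> of points reached from \<open>x\<close> in as many steps as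
  some loop at \<open>x\<close> takes is clopen, hence contains \<open>f x\<close>. This yields
  loops of two consecutive lengths, hence of all large lengths.\<close>

lemma chain_mixing:
  fixes f :: "'a::metric_space \<Rightarrow> 'a"
  assumes f: "continuous_on UNIV f" and conn: "connected (UNIV :: 'a set)"
    and trans: "\<And>x y. chain_to f x y" and \<delta>: "\<delta> > 0"
  obtains j where "j > 0" "\<And>i. i \<ge> j \<Longrightarrow> (x, y) \<in> chain_step f \<delta> ^^ i"
proof -
  let ?R = "chain_step f \<delta>"
  have reach: "\<exists>n>0. (u, v) \<in> ?R ^^ n" for u v
    using trans[of u v] \<delta> by (auto simp: chain_to_iff trancl_power)
  have comp: "(u, w) \<in> ?R ^^ (m + n)" if "(u, v) \<in> ?R ^^ m" "(v, w) \<in> ?R ^^ n" for u v w m n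
    using that by (auto simp: relpow_add)
  have open_right: "\<exists>e>0. \<forall>v'. dist v' v < e \<longrightarrow> (u, v') \<in> ?R ^^ n"
    if "(u, v) \<in> ?R ^^ n" "n > 0" for u v n
  proof -
    obtain m where m: "n = Suc m"
      using \<open>n > 0\<close> gr0_implies_Suc by blast
    with that(1) have "(u, v) \<in> ?R ^^ m O ?R" by simp
    then obtain s where s: "(u, s) \<in> ?R ^^ m" "dist (f s) v < \<delta>"
      by (auto elim: relcompE)
    have "(u, v') \<in> ?R ^^ n" if "dist v' v < \<delta> - dist (f s) v" for v'
      using dist_triangle[of "f s" v' v] s that unfolding m
      by (intro relpow_Suc_I[of _ s]) (auto simp: dist_commute)
    then show ?thesis
      using s by (intro exI[of _ "\<delta> - dist (f s) v"]) auto
  qed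
  have open_left: "\<exists>e>0. \<forall>u'. dist u' u < e \<longrightarrow> (u', v) \<in> ?R ^^ n"
    if "(u, v) \<in> ?R ^^ n" "n > 0" for u v n
  proof -
    obtain m where m: "n = Suc m"
      using \<open>n > 0\<close> gr0_implies_Suc by blast
    with that(1) have "(u, v) \<in> ?R O ?R ^^ m" by (simp add: relpow_commute)
    then obtain s where s: "(s, v) \<in> ?R ^^ m" "dist (f u) s < \<delta>"
      by (auto elim: relcompE)
    obtain e where e: "e > 0" "\<And>u'. dist u' u < e \<Longrightarrow> dist (f u') (f u) < \<delta> - dist (f u) s"
      using f s unfolding continuous_on_iff by (metis UNIV_I diff_gt_0_iff_gt)
    have "(u', v) \<in> ?R ^^ n" if "dist u' u < e" for u'
      using dist_triangle[of "f u'" s "f u"] s e(2)[OF that] unfolding m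
      by (intro relpow_Suc_I2[of _ s]) auto
    then show ?thesis
      using e by auto
  qed
  define A where "A = {v. \<exists>n>0. (x, v) \<in> ?R ^^ n \<and> (x, x) \<in> ?R ^^ n}"
  have "x \<in> A"
    using reach[of x x] by (auto simp: A_def)
  moreover have "open A"
    unfolding open_dist
  proof
    fix v assume "v \<in> A"
    then obtain n where n: "n > 0" "(x, v) \<in> ?R ^^ n" "(x, x) \<in> ?R ^^ n"
      by (auto simp: A_def)
    from open_right[OF n(2,1)] n show "\<exists>e>0. \<forall>w. dist w v < e \<longrightarrow> w \<in> A"
      unfolding A_def by blast
  qed
  moreover have "closed A"
    unfolding closure_subset_eq[symmetric] subset_iff closure_approachable
  proof (intro allI impI)
    fix v assume approx: "\<forall>e>0. \<exists>w\<in>A. dist w v < e"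
    \<comment> \<open>The lengths \<open>m\<close> and \<open>k\<close> are fixed at
      \<open>v\<close> before \<open>w\<close> is chosen, so \<open>e1\<close> and \<open>e2\<close>
      depend only on \<open>v\<close>.\<close>
    obtain m where m: "m > 0" "(v, v) \<in> ?R ^^ m" using reach by blast
    obtain k where k: "k > 0" "(v, x) \<in> ?R ^^ k" using reach by blast
    obtain e1 where e1: "e1 > 0" "\<And>w. dist w v < e1 \<Longrightarrow> (w, v) \<in> ?R ^^ m"
      using open_left[OF m(2,1)] by blast
    obtain e2 where e2: "e2 > 0" "\<And>w. dist w v < e2 \<Longrightarrow> (w, x) \<in> ?R ^^ k"
      using open_left[OF k(2,1)] by blast
    obtain w where w: "w \<in> A" "dist w v < min e1 e2"
      using approx e1(1) e2(1) by (meson min_less_iff_conj)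
    obtain n where n: "n > 0" "(x, w) \<in> ?R ^^ n" "(x, x) \<in> ?R ^^ n"
      using w(1) by (auto simp: A_def)
    have wv: "(w, v) \<in> ?R ^^ m" and wx: "(w, x) \<in> ?R ^^ k"
      using e1(2)[of w] e2(2)[of w] w(2) by auto
    \<comment> \<open>Both walks have length \<open>2 n + m + k\<close>: \<open>x, w, x, w, v\<close> and \<open>x, x, w, v, x\<close>.\<close>
    have "(x, v) \<in> ?R ^^ ((n + k) + (n + m))"
      using comp[OF comp[OF n(2) wx] comp[OF n(2) wv]] .
    moreover have "(x, x) \<in> ?R ^^ (n + ((n + m) + k))"
      using comp[OF n(3) comp[OF comp[OF n(2) wv] k(2)]] .
    moreover have "n + ((n + m) + k) = (n + k) + (n + m)"
      by simp
    ultimately show "v \<in> A"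
      unfolding A_def using n(1) by (metis (mono_tags, lifting) add_gr_0 mem_Collect_eq)
  qed
  ultimately have "A = UNIV"
    using conn unfolding connected_clopen by auto
  then obtain n where n: "n > 0" "(x, f x) \<in> ?R ^^ n"  "(x, x) \<in> ?R ^^ n"
    unfolding A_def by blast
  obtain k where k: "(f x, x) \<in> ?R ^^ k" "k > 0" using reach by blast
  \<comment> \<open>The point \<open>f x\<close> is reached in \<open>n\<close> steps, but also by a
    loop of length \<open>n\<close> followed by one step; returning by the same \<open>k\<close>
    steps gives loop lengths differing by one.\<close>
  have one: "(x, f x) \<in> ?R ^^ 1" using \<delta> by simp
  have "(x, x) \<in> ?R ^^ (n + k)"
    using comp[OF n(2) k(1)] .
  moreover have "(x, x) \<in> ?R ^^ Suc (n + k)"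
    using comp[OF n(3) comp[OF one k(1)]] by simp
  ultimately have cyc: "(x, x) \<in> ?R ^^ N" if "N \<ge> (n + k) * (n + k)" for N
    using semigroup_consecutive_cofinite[of "{n. (x, x) \<in> ?R ^^ n}" "n + k" N] comp n(1) that by auto
  obtain l where l: "l > 0" "(x, y) \<in> ?R ^^ l" using reach by blast
  have "(x, y) \<in> ?R ^^ i" if "i \<ge> (n + k) * (n + k) + l" for i
    using comp[OF cyc[of "i - l"] l(2)] that by simp
  then show thesis
    using that[of "(n + k) * (n + k) + l"] l(1) by blast
qed

text \<open>A chain from \<open>x\<close> to \<open>y\<close> of length exactly \<open>i\<close> is
  shadowed by an orbit that starts in \<open>U\<close> and is in \<open>V\<close> at time
  \<open>i\<close>; \<open>chain_mixing\<close> supplies every large \<open>i\<close>.\<close>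

lemma shadowing_imp_mixing:
  fixes f :: "'a::metric_space \<Rightarrow> 'a"
  assumes "continuous_on UNIV f" "connected (UNIV :: 'a set)"
    and "\<And>x y. chain_to f x y" and shad: "shadowing_on f UNIV"
  shows "mixing f"
  unfolding mixing_def
proof (intro allI impI)
  fix U V :: "'a set"
  assume "open U \<and> U \<noteq> {} \<and> open V \<and> V \<noteq> {}"
  then obtain x y r s where xy: "r > 0" "cball x r \<subseteq> U" "s > 0" "cball y s \<subseteq> V"
    by (meson ex_in_conv open_contains_cball)
  define \<epsilon> where "\<epsilon> = min r s"
  have "\<epsilon> > 0" using xy by (simp add: \<epsilon>_def)
  then obtain \<delta> where \<delta>: "\<delta> > 0"
    "\<And>k c. delta_chain f \<delta> k c \<Longrightarrow> \<exists>z. \<forall>i\<le>k. dist (c i) ((f ^^ i) z) \<le> \<epsilon>"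
    using shad unfolding shadowing_on_def by (metis UNIV_I)
  obtain j where j: "j > 0" "\<And>i. i \<ge> j \<Longrightarrow> (x, y) \<in> chain_step f \<delta> ^^ i"
    using chain_mixing[OF assms(1-3) \<delta>(1)] by metis
  show "\<exists>j. \<forall>i\<ge>j. (f ^^ i) ` U \<inter> V \<noteq> {}"
  proof (intro exI allI impI)
    fix i assume "i \<ge> j"
    with j obtain c where c: "delta_chain f \<delta> i c" "c 0 = x" "c i = y"
      using delta_chain_of_relpow[of x y i f \<delta>] by (metis One_nat_def Suc_leI less_le_trans)
    then obtain z where z: "\<And>m. m \<le> i \<Longrightarrow> dist (c m) ((f ^^ m) z) \<le> \<epsilon>"
      using \<delta>(2) by blast
    have "z \<in> U" "(f ^^ i) z \<in> V"
      using z[of 0] z[of i] c xy by (auto simp: \<epsilon>_def subset_iff)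
    then show "(f ^^ i) ` U \<inter> V \<noteq> {}"
      by blast
  qed
qed

subsection \<open>The chain class of an interior point\<close>

locale shadowed_chain_class =
  fixes f :: "'a::metric_space \<Rightarrow> 'a" and \<Lambda> U :: "'a set" and b :: real and p :: 'a
  assumes compact: "compact (UNIV :: 'a set)"
    and bij: "bij f" and cont: "continuous_on UNIV f" and cont_inv: "continuous_on UNIV (inv f)"
    and closed: "closed \<Lambda>" and invariant: "f ` \<Lambda> \<subseteq> \<Lambda>"
    and U: "open U" "connected U" "U \<subseteq> \<Lambda>" "U \<subseteq> chain_recurrent f" "p \<in> U"
    and b: "b > 0"
    and shadowing: "shadowing_on f (closed_nbhd b \<Lambda>)"
    and L_shadowing: "L_shadowing_on f (closed_nbhd b \<Lambda>)"
begin

section \<open>Invariance of the chain class under \<open>f\<close> and its inverse\<close>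

definition C where "C = {y. chain_to f p y}"

lemma uniformly_continuous:
  assumes "e > 0"
  obtains d where "d > 0" "\<And>x y. dist x y < d \<Longrightarrow> dist (f x) (f y) < e"
  using compact_uniformly_continuous[OF cont compact] assms
  unfolding uniformly_continuous_on_def by (metis UNIV_I dist_commute)

lemma uniformly_continuous_inverse:
  assumes "e > 0"
  obtains d where "d > 0" "\<And>x y. dist (f x) (f y) < d \<Longrightarrow> dist x y < e"
proof -
  obtain d where "d > 0" "\<And>x y. dist x y < d \<Longrightarrow> dist (inv f x) (inv f y) < e"
    using compact_uniformly_continuous[OF cont_inv compact] assms
    unfolding uniformly_continuous_on_def by (metis UNIV_I dist_commute)
  then show thesis
    using that bij by (metis bij_is_inj inv_f_f)
qed

lemma funpow_invariant: "x \<in> \<Lambda> \<Longrightarrow> (f ^^ n) x \<in> \<Lambda>"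
  using invariant by (induction n) auto

lemma chain_to_U: "x \<in> U \<Longrightarrow> y \<in> U \<Longrightarrow> chain_to f x y"
  using chain_to_connected[OF cont U(2,4)] .

lemma U_subset_C: "U \<subseteq> C"
  using chain_to_U U(5) by (auto simp: C_def)

lemma image_in_C: "x \<in> C \<Longrightarrow> f x \<in> C"
  unfolding C_def using chain_to_trans chain_to_image by blast

text \<open>The last step of a chain to \<open>f x\<close> leaves from some \<open>u\<close> with
  \<open>f u\<close> near \<open>f x\<close>. Uniform continuity of the inverse puts
  \<open>u\<close> near \<open>x\<close>, so the chain can end at \<open>x\<close> instead.\<close>

lemma preimage_in_C:
  assumes "f x \<in> C" shows "x \<in> C"
  unfolding C_def mem_Collect_eq chain_to_iff
proof (intro allI impI)
  fix \<delta> :: real assume "\<delta> > 0"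
  then obtain d where d: "d > 0" "\<And>u v. dist (f u) (f v) < d \<Longrightarrow> dist u v < \<delta> / 2"
    using uniformly_continuous_inverse[of "\<delta> / 2"] by auto
  define \<gamma> where "\<gamma> = min d (\<delta> / 2)"
  have "\<gamma> > 0" using d \<open>\<delta> > 0\<close> by (simp add: \<gamma>_def)
  then have "(p, f x) \<in> (chain_step f \<gamma>)\<^sup>+" "(p, p) \<in> (chain_step f \<gamma>)\<^sup>+"
    using assms U_subset_C U(5) by (auto simp: C_def chain_to_iff)
  \<comment> \<open>Prepending a loop at \<open>p\<close> ensures that \<open>u\<close> is reached
    in at least one step.\<close>
  then obtain u where u: "(p, u) \<in> (chain_step f \<gamma>)\<^sup>+" "dist (f u) (f x) < \<gamma>"
    by (metis chain_step_iff tranclD2 trancl_rtrancl_trancl)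
  then have "dist u x < \<delta> / 2"
    using d(2) by (simp add: \<gamma>_def)
  with u(1) show "(p, x) \<in> (chain_step f \<delta>)\<^sup>+"
    by (rule trancl_chain_step_end) (simp add: \<gamma>_def)
qed

lemma funpow_in_C_iff: "(f ^^ n) x \<in> C \<longleftrightarrow> x \<in> C"
proof (induction n)
  case (Suc n)
  have "f u \<in> C \<longleftrightarrow> u \<in> C" for u
    using image_in_C preimage_in_C by blast
  with Suc show ?case by simp
qed simp

section \<open>Stability: chains from \<open>p\<close> stay near \<open>\<Lambda>\<close>\<close>

text \<open>Shadowing is available only inside the neighbourhood, so induction along the chain
  proves both claims: a segment inside is shadowed by an orbit from \<open>U\<close>, which remains
  in \<open>\<Lambda>\<close> and keeps the next point within \<open>b\<close> of it.\<close>

lemma chains_shadowed: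
  assumes "\<epsilon> > 0"
  shows "\<exists>\<delta>>0. \<forall>y. (p, y) \<in> (chain_step f \<delta>)\<^sup>+ \<longrightarrow>
    y \<in> closed_nbhd b \<Lambda> \<and> (\<exists>z k. dist p z \<le> \<epsilon> \<and> dist y ((f ^^ k) z) \<le> \<epsilon>)"
proof -
  obtain r where r: "r > 0" "cball p r \<subseteq> U"
    using U(1,5) open_contains_cball by blast
  obtain e where e: "e > 0" "\<And>x y. dist x y < e \<Longrightarrow> dist (f x) (f y) < b / 2"
    using uniformly_continuous[of "b / 2"] b by auto
  \<comment> \<open>The bound \<open>r\<close> puts the shadowing point in \<open>U\<close>;
    \<open>e / 2\<close> makes the error at most \<open>b / 2\<close> after one application of
    \<open>f\<close>. The jump uses the other \<open>b / 2\<close>.\<close>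
  define \<epsilon>' where "\<epsilon>' = min \<epsilon> (min r (e / 2))"
  have "\<epsilon>' > 0" using assms r e by (simp add: \<epsilon>'_def)
  then obtain \<delta>0 where \<delta>0: "\<delta>0 > 0"
    "\<And>k c. delta_chain f \<delta>0 k c \<Longrightarrow> \<forall>i\<le>k. c i \<in> closed_nbhd b \<Lambda> \<Longrightarrow>
       \<exists>z. \<forall>i\<le>k. dist (c i) ((f ^^ i) z) \<le> \<epsilon>'"
    using shadowing unfolding shadowing_on_def by metis
  define \<delta> where "\<delta> = min \<delta>0 (b / 2)"
  have "\<delta> > 0" using \<delta>0 b by (simp add: \<delta>_def)
  have pL: "p \<in> \<Lambda>" using U by blast
  have near: "\<exists>z. dist p z \<le> \<epsilon>' \<and> dist (c n) ((f ^^ n) z) \<le> \<epsilon>'"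
    if c: "c 0 = p" "\<forall>i<n. dist (f (c i)) (c (Suc i)) < \<delta>" "\<forall>i\<le>n. c i \<in> closed_nbhd b \<Lambda>" for c n
  \<comment> \<open>A \<open>delta_chain\<close> has at least one step, so length zero is treated
    directly.\<close>
  proof (cases "n = 0")
    case True
    then show ?thesis using c \<open>\<epsilon>' > 0\<close> by (intro exI[of _ p]) auto
  next
    case False
    then have "delta_chain f \<delta>0 n c"
      using c by (auto simp: delta_chain_def \<delta>_def intro: less_imp_le)
    then obtain z where "\<forall>i\<le>n. dist (c i) ((f ^^ i) z) \<le> \<epsilon>'"
      using \<delta>0(2) c(3) by blast
    then show ?thesis
      using c(1) by (metis funpow_0 le0 order_refl)
  qed
  have stay: "\<forall>i\<le>n. c i \<in> closed_nbhd b \<Lambda>"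
    if "c 0 = p" "\<forall>i<n. dist (f (c i)) (c (Suc i)) < \<delta>" for c n
    using that
  proof (induction n)
    case 0
    then show ?case using pL b by (simp add: closed_nbhd_def)
  next
    case (Suc n)
    then have IH: "\<forall>i\<le>n. c i \<in> closed_nbhd b \<Lambda>" by simp
    obtain z where z: "dist p z \<le> \<epsilon>'" "dist (c n) ((f ^^ n) z) \<le> \<epsilon>'"
      using near[of c n] Suc.prems IH by auto
    have "z \<in> \<Lambda>" using z r U(3) by (auto simp: \<epsilon>'_def subset_iff)
    then have "f ((f ^^ n) z) \<in> \<Lambda>" using funpow_invariant[of z "Suc n"] by simp
    then have "infdist (c (Suc n)) \<Lambda> \<le> dist (c (Suc n)) (f ((f ^^ n) z))"
      by (rule infdist_le)
    also have "\<dots> \<le> dist (c (Suc n)) (f (c n)) + dist (f (c n)) (f ((f ^^ n) z))"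
      by (rule dist_triangle)
    also have "\<dots> \<le> b / 2 + b / 2"
    proof (rule add_mono)
      show "dist (c (Suc n)) (f (c n)) \<le> b / 2"
        using Suc.prems(2) by (auto simp: \<delta>_def dist_commute less_Suc_eq intro: less_imp_le)
      have "dist (c n) ((f ^^ n) z) < e"
        using z(2) e(1) unfolding \<epsilon>'_def by linarith
      then show "dist (f (c n)) (f ((f ^^ n) z)) \<le> b / 2"
        using e(2) less_imp_le by blast
    qed
    finally have "c (Suc n) \<in> closed_nbhd b \<Lambda>"
      by (simp add: closed_nbhd_def)
    with IH show ?case by (auto simp: le_Suc_eq)
  qed
  show ?thesis
  proof (intro exI[of _ \<delta>] conjI[OF \<open>\<delta> > 0\<close>] allI impI)
    fix y assume "(p, y) \<in> (chain_step f \<delta>)\<^sup>+"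
    then obtain n c where c: "c 0 = p" "c n = y" "\<forall>i<n. dist (f (c i)) (c (Suc i)) < \<delta>"
      by (auto simp: trancl_power relpow_fun_conv)
    have nb: "\<forall>i\<le>n. c i \<in> closed_nbhd b \<Lambda>" using stay c by blast
    obtain z where "dist p z \<le> \<epsilon>'" "dist y ((f ^^ n) z) \<le> \<epsilon>'"
      using near[OF c(1,3) nb] c(2) by blast
    then have "dist p z \<le> \<epsilon>" "dist y ((f ^^ n) z) \<le> \<epsilon>"
      by (auto simp: \<epsilon>'_def)
    with nb c(2) show "y \<in> closed_nbhd b \<Lambda> \<and> (\<exists>z k. dist p z \<le> \<epsilon> \<and> dist y ((f ^^ k) z) \<le> \<epsilon>)"
      by blast
  qed
qed

text \<open>This reduces claims about \<open>C\<close> to forward orbits of points of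
  \<open>U\<close>, which stay in \<open>\<Lambda>\<close> and are chain recurrent.\<close>

lemma C_approx:
  assumes "y \<in> C" "\<epsilon> > 0"
  obtains z k where "z \<in> U" "dist y ((f ^^ k) z) < \<epsilon>"
proof -
  obtain r where r: "r > 0" "cball p r \<subseteq> U"
    using U(1,5) open_contains_cball by blast
  define \<epsilon>' where "\<epsilon>' = min r (\<epsilon> / 2)"
  have "\<epsilon>' > 0" using assms r by (simp add: \<epsilon>'_def)
  obtain \<delta> where \<delta>: "\<delta> > 0" "\<forall>y. (p, y) \<in> (chain_step f \<delta>)\<^sup>+ \<longrightarrow>
      y \<in> closed_nbhd b \<Lambda> \<and> (\<exists>z k. dist p z \<le> \<epsilon>' \<and> dist y ((f ^^ k) z) \<le> \<epsilon>')"
    using chains_shadowed[OF \<open>\<epsilon>' > 0\<close>] by (elim exE conjE)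
  have "(p, y) \<in> (chain_step f \<delta>)\<^sup>+"
    using assms(1) \<delta>(1) by (simp add: C_def chain_to_iff)
  with \<delta>(2) obtain z k where "dist p z \<le> \<epsilon>'" "dist y ((f ^^ k) z) \<le> \<epsilon>'"
    by blast
  then have "z \<in> U" "dist y ((f ^^ k) z) < \<epsilon>"
    using r assms(2) by (auto simp: \<epsilon>'_def subset_iff)
  then show thesis by (rule that)
qed

lemma C_subset: "C \<subseteq> \<Lambda>"
proof
  fix y assume "y \<in> C"
  then have "\<exists>u\<in>\<Lambda>. dist u y < e" if "e > 0" for e
    using C_approx[OF \<open>y \<in> C\<close> that] funpow_invariant U(3) by (metis dist_commute subsetD)
  then show "y \<in> \<Lambda>"
    using closed closed_approachable by blast
qed

text \<open>Near \<open>y\<close> lies some \<open>(f ^^ k) z\<close> with \<open>z\<close> in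
  \<open>U\<close>. It chains back to \<open>z\<close> by recurrence and on to \<open>p\<close>;
  continuity moves the start to \<open>y\<close>.\<close>

lemma chain_to_base:
  assumes "y \<in> C" shows "chain_to f y p"
  unfolding chain_to_iff
proof (intro allI impI)
  fix \<delta> :: real assume "\<delta> > 0"
  then obtain d where d: "d > 0" "\<And>u v. dist u v < d \<Longrightarrow> dist (f u) (f v) < \<delta> / 2"
    using uniformly_continuous[of "\<delta> / 2"] by auto
  obtain z k where z: "z \<in> U" "dist y ((f ^^ k) z) < d"
    using C_approx[OF assms d(1)] .
  have "chain_to f ((f ^^ k) z) p"
    using chain_to_funpow_left[OF cont] chain_to_U z(1) U(5) chain_to_trans by blast
  then have "((f ^^ k) z, p) \<in> (chain_step f (\<delta> / 2))\<^sup>+"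
    using \<open>\<delta> > 0\<close> by (simp add: chain_to_iff)
  moreover have "dist (f ((f ^^ k) z)) (f y) < \<delta> / 2"
    using d(2)[OF z(2)] by (simp add: dist_commute)
  ultimately show "(y, p) \<in> (chain_step f \<delta>)\<^sup>+"
    by (rule trancl_chain_step_start) simp
qed

section \<open>Attraction by the class, and its openness\<close>

text \<open>Only the two limits of L-shadowing are used, so its accuracy is simply \<open>1\<close>:
  the backward limit places \<open>z\<close> in \<open>C\<close>, the forward one brings the orbit
  of \<open>w\<close> to that of \<open>z\<close>.\<close>

lemma C_attracts:
  obtains \<eta> where "\<eta> > 0"
    "\<And>y w e. y \<in> C \<Longrightarrow> dist y w < \<eta> \<Longrightarrow> e > 0 \<Longrightarrow> \<exists>n\<ge>1. \<exists>c\<in>C. dist ((f ^^ n) w) c < e"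
proof -
  obtain \<delta> where \<delta>: "\<delta> > 0" "\<And>y. (p, y) \<in> (chain_step f \<delta>)\<^sup>+ \<Longrightarrow> y \<in> closed_nbhd b \<Lambda>"
    using chains_shadowed[of 1] by (metis zero_less_one)
  obtain \<delta>L where \<delta>L: "\<delta>L > 0" "\<And>x. limit_pseudo_orbit f \<delta>L x \<Longrightarrow> \<forall>i. x i \<in> closed_nbhd b \<Lambda> \<Longrightarrow>
      \<exists>z. ((\<lambda>i. dist (x i) (int_iter f i z)) \<longlongrightarrow> 0) at_bot \<and>
          ((\<lambda>i. dist (x i) (int_iter f i z)) \<longlongrightarrow> 0) at_top"
    using L_shadowing unfolding L_shadowing_on_def by (metis zero_less_one)
  \<comment> \<open>The bound \<open>\<delta> / 2\<close> keeps the forward orbit of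
    \<open>w\<close> in the neighbourhood; \<open>\<delta>L\<close> admits the jump from
    \<open>y\<close> to \<open>w\<close>.\<close>
  define \<eta> where "\<eta> = min (\<delta> / 2) \<delta>L"
  show thesis
  proof (rule that)
    show "\<eta> > 0" using \<delta> \<delta>L by (simp add: \<eta>_def)
    fix y w and e :: real assume y: "y \<in> C" and w: "dist y w < \<eta>" and e: "e > 0"
    have inv_C: "(inv f ^^ n) y \<in> C" for n
    proof (induction n)
      case (Suc n)
      then show ?case
        using preimage_in_C bij by (simp add: bij_is_surj surj_f_inv_f)
    qed (use y in auto)
    \<comment> \<open>At index \<open>0\<close> the point \<open>w\<close> replaces
      \<open>y\<close>, so the only jump is out of index \<open>-1\<close>.\<close>
    define x where "x i = (if i < 0 then int_iter f i y else int_iter f i w)" for i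
    have step: "f (x i) = x (i + 1)" if "i \<noteq> -1" for i
    proof (cases "i \<ge> 0")
      case True
      then have "nat (i + 1) = Suc (nat i)" by simp
      with True show ?thesis by (simp add: x_def int_iter_def)
    next
      case False
      with that have "nat (- i) = Suc (nat (- (i + 1)))" "i + 1 < 0" by auto
      with False show ?thesis
        using bij by (simp add: x_def int_iter_def bij_is_surj surj_f_inv_f)
    qed
    have jump: "f (x (-1)) = y" "x 0 = w"
      using bij by (auto simp: x_def int_iter_def bij_is_surj surj_f_inv_f)
    have "limit_pseudo_orbit f \<delta>L x"
      unfolding limit_pseudo_orbit_def
    proof (intro conjI allI)
      show "dist (f (x i)) (x (i + 1)) \<le> \<delta>L" for i
        using step[of i] jump w \<delta>L(1) by (cases "i = -1") (auto simp: \<eta>_def)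
      have "eventually (\<lambda>i. dist (f (x i)) (x (i + 1)) = 0) at_bot"
        using eventually_le_at_bot[of "-2::int"] by eventually_elim (use step in auto)
      then show "((\<lambda>i. dist (f (x i)) (x (i + 1))) \<longlongrightarrow> 0) at_bot"
        by (rule tendsto_eventually)
      have "eventually (\<lambda>i. dist (f (x i)) (x (i + 1)) = 0) at_top"
        using eventually_ge_at_top[of "0::int"] by eventually_elim (use step in auto)
      then show "((\<lambda>i. dist (f (x i)) (x (i + 1))) \<longlongrightarrow> 0) at_top"
        by (rule tendsto_eventually)
    qed
    moreover have "\<forall>i. x i \<in> closed_nbhd b \<Lambda>"
    proof
      fix i
      have "(p, y) \<in> (chain_step f (\<delta> / 2))\<^sup>+"
        using y \<delta>(1) by (simp add: C_def chain_to_iff)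
      then have "(p, w) \<in> (chain_step f \<delta>)\<^sup>+"
        by (rule trancl_chain_step_end[where \<eta> = "\<delta> / 2"]) (use w in \<open>auto simp: \<eta>_def\<close>)
      then have fw: "(p, (f ^^ n) w) \<in> (chain_step f \<delta>)\<^sup>+" for n
        using rtrancl_chain_step_funpow[OF \<delta>(1)] trancl_rtrancl_trancl by metis
      have "(p, x i) \<in> (chain_step f \<delta>)\<^sup>+"
        using inv_C fw \<delta>(1) by (auto simp: x_def int_iter_def C_def chain_to_iff)
      then show "x i \<in> closed_nbhd b \<Lambda>" by (rule \<delta>(2))
    qed
    ultimately obtain z where
      bot: "((\<lambda>i. dist (x i) (int_iter f i z)) \<longlongrightarrow> 0) at_bot" and
      top: "((\<lambda>i. dist (x i) (int_iter f i z)) \<longlongrightarrow> 0) at_top"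
      using \<delta>L(2) by blast
    \<comment> \<open>Far back, the orbit of \<open>z\<close> is close to a point of
      \<open>C\<close>, so a chain from \<open>p\<close> can end on it; the true orbit then leads to
      \<open>z\<close>.\<close>
    have "z \<in> C"
      unfolding C_def mem_Collect_eq chain_to_iff
    proof (intro allI impI)
      fix \<gamma> :: real assume \<gamma>: "\<gamma> > 0"
      have "eventually (\<lambda>i. dist (x i) (int_iter f i z) < \<gamma> / 2 \<and> i \<le> -1) at_bot"
        using order_tendstoD(2)[OF bot, of "\<gamma> / 2"] \<gamma> eventually_le_at_bot[of "-1::int"]
        by (intro eventually_conj) simp_all
      then obtain i where i: "dist (x i) (int_iter f i z) < \<gamma> / 2" "i < 0"
        using eventually_happens[of _ "at_bot :: int filter"] by fastforce
      define m where "m = nat (- i)"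
      have m: "x i = (inv f ^^ m) y" "int_iter f i z = (inv f ^^ m) z"
        using i(2) by (auto simp: x_def int_iter_def m_def)
      have "(p, x i) \<in> (chain_step f (\<gamma> / 2))\<^sup>+"
        using inv_C[of m] m \<gamma> by (simp add: C_def chain_to_iff)
      then have "(p, (inv f ^^ m) z) \<in> (chain_step f \<gamma>)\<^sup>+"
        by (rule trancl_chain_step_end[where \<eta> = "\<gamma> / 2"]) (use i m in auto)
      moreover have "(f ^^ m) ((inv f ^^ m) z) = z"
        using bij by (metis bij_fn bij_is_surj inv_fn surj_f_inv_f)
      ultimately show "(p, z) \<in> (chain_step f \<gamma>)\<^sup>+"
        using rtrancl_chain_step_funpow[OF \<gamma>] trancl_rtrancl_trancl by metis
    qed
    have "eventually (\<lambda>i. dist (x i) (int_iter f i z) < e \<and> i \<ge> 1) at_top"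
      using order_tendstoD(2)[OF top, of e] e eventually_ge_at_top[of "1::int"]
      by (intro eventually_conj)
    then obtain i where i: "dist (x i) (int_iter f i z) < e" "i \<ge> 1"
      using eventually_happens[of _ "at_top :: int filter"] by fastforce
    then have "nat i \<ge> 1" "dist ((f ^^ nat i) w) ((f ^^ nat i) z) < e"
      by (auto simp: x_def int_iter_def)
    then show "\<exists>n\<ge>1. \<exists>c\<in>C. dist ((f ^^ n) w) c < e"
      using \<open>z \<in> C\<close> funpow_in_C_iff by blast
  qed
qed

lemma closed_C: "closed C"
  unfolding C_def by (rule closed_chain_to)

lemma open_C: "open C"
proof -
  obtain \<eta> where \<eta>: "\<eta> > 0"
    "\<And>y w e. y \<in> C \<Longrightarrow> dist y w < \<eta> \<Longrightarrow> e > 0 \<Longrightarrow> \<exists>n\<ge>1. \<exists>c\<in>C. dist ((f ^^ n) w) c < e"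
    using C_attracts by blast
  obtain \<delta> where \<delta>: "\<delta> > 0" "\<And>y. (p, y) \<in> (chain_step f \<delta>)\<^sup>+ \<Longrightarrow> y \<in> closed_nbhd b \<Lambda>"
    using chains_shadowed[of 1] by (metis zero_less_one)
  obtain r where r: "r > 0" "cball p r \<subseteq> U"
    using U(1,5) open_contains_cball by blast
  have "w \<in> C" if y: "y \<in> C" and w: "dist y w < min \<eta> (\<delta> / 2)" for y w
  proof (rule ccontr)
    assume "w \<notin> C"
    then obtain s where s: "s > 0" "cball w s \<subseteq> - C"
      using closed_C open_contains_cball[of "- C"] by (auto simp: open_Compl)
    \<comment> \<open>The bound \<open>s\<close> will keep the start of the shadowing orbit outside
      \<open>C\<close>, while \<open>r\<close> puts its end in \<open>U\<close>; invariance of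
      \<open>C\<close> makes these contradictory.\<close>
    define \<epsilon> where "\<epsilon> = min r s"
    have "\<epsilon> > 0" using r s by (simp add: \<epsilon>_def)
    then obtain \<gamma>0 where \<gamma>0: "\<gamma>0 > 0"
      "\<And>k c. delta_chain f \<gamma>0 k c \<Longrightarrow> \<forall>i\<le>k. c i \<in> closed_nbhd b \<Lambda> \<Longrightarrow>
         \<exists>z. \<forall>i\<le>k. dist (c i) ((f ^^ i) z) \<le> \<epsilon>"
      using shadowing unfolding shadowing_on_def by metis
    \<comment> \<open>With \<open>\<gamma> \<le> \<delta>\<close>, every point of the chain from
      \<open>w\<close> is also reached from \<open>p\<close> by a \<open>\<delta>\<close>-chain,
      hence lies where shadowing applies.\<close>
    define \<gamma> where "\<gamma> = min \<gamma>0 \<delta>"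
    have \<gamma>: "\<gamma> > 0" using \<gamma>0 \<delta> by (simp add: \<gamma>_def)
    obtain n u where n: "n \<ge> 1" "u \<in> C" "dist ((f ^^ n) w) u < \<gamma>"
      using \<eta>(2)[OF y _ \<gamma>] w by (meson min_less_iff_conj)
    \<comment> \<open>The jump replaces the last orbit step: it leaves \<open>(f ^^ m) w\<close> and
      lands on \<open>u\<close> instead of \<open>(f ^^ n) w\<close>.\<close>
    obtain m where m: "n = Suc m" using n(1) by (cases n) auto
    have "((f ^^ m) w, u) \<in> chain_step f \<gamma>"
      using n(3) m by simp
    moreover have "(u, p) \<in> (chain_step f \<gamma>)\<^sup>+"
      using chain_to_base[OF n(2)] \<gamma> by (simp add: chain_to_iff)
    ultimately have "(w, p) \<in> (chain_step f \<gamma>)\<^sup>+"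
      using rtrancl_chain_step_funpow[OF \<gamma>, of w m f] by (meson rtrancl_into_trancl1 trancl_trans)
    then obtain k where k: "k > 0" "(w, p) \<in> chain_step f \<gamma> ^^ k"
      by (auto simp: trancl_power)
    obtain c where c: "delta_chain f \<gamma> k c" "c 0 = w" "c k = p"
      "\<And>i. i < k \<Longrightarrow> (c i, c (Suc i)) \<in> chain_step f \<gamma>"
      using delta_chain_of_relpow[OF k(2)] k(1) by (metis One_nat_def Suc_leI)
    have "(p, y) \<in> (chain_step f (\<delta> / 2))\<^sup>+"
      using y \<delta>(1) by (simp add: C_def chain_to_iff)
    then have pw: "(p, w) \<in> (chain_step f \<delta>)\<^sup>+"
      by (rule trancl_chain_step_end[where \<eta> = "\<delta> / 2"]) (use w in auto)
    have "(p, c i) \<in> (chain_step f \<delta>)\<^sup>+" if "i \<le> k" for i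
      using that
    proof (induction i)
      case (Suc i)
      then have "(c i, c (Suc i)) \<in> chain_step f \<delta>"
        using c(4)[of i] chain_step_mono[of \<gamma> \<delta> f] by (auto simp: \<gamma>_def)
      with Suc show ?case by (meson Suc_leD trancl_into_trancl)
    qed (simp add: c pw)
    then have "\<forall>i\<le>k. c i \<in> closed_nbhd b \<Lambda>"
      using \<delta>(2) by blast
    moreover have "delta_chain f \<gamma>0 k c"
      using c(1) by (auto simp: delta_chain_def \<gamma>_def)
    ultimately obtain z where z: "\<And>i. i \<le> k \<Longrightarrow> dist (c i) ((f ^^ i) z) \<le> \<epsilon>"
      using \<gamma>0(2) by blast
    have "(f ^^ k) z \<in> U"
      using z[of k] c(3) r by (auto simp: \<epsilon>_def subset_iff)
    then have "z \<in> C"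
      using U_subset_C funpow_in_C_iff by blast
    moreover have "z \<notin> C"
      using z[of 0] c(2) s by (auto simp: \<epsilon>_def subset_iff)
    ultimately show False by blast
  qed
  then show ?thesis
    unfolding open_dist using \<eta>(1) \<delta>(1)
    by (metis dist_commute half_gt_zero min_less_iff_conj)
qed

lemma C_eq_UNIV:
  assumes "connected (UNIV :: 'a set)" shows "C = UNIV"
  using assms open_C closed_C U_subset_C U(5)
  unfolding connected_clopen by auto

end

theorem corollary1p1:
  fixes f :: "'a::metric_space \<Rightarrow> 'a" and \<Lambda> :: "'a set"
  assumes "compact (UNIV :: 'a set)"
    and "\<exists>g. homeomorphism UNIV UNIV f g"
    and "closed \<Lambda>"
    and "invariant_set f \<Lambda>"
    and "connected (UNIV :: 'a set)"
    and "locally connected (UNIV :: 'a set)"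
    and "interior \<Lambda> \<inter> interior (chain_recurrent f) \<noteq> {}"
    and "\<exists>b>0. shadowing_on f (closed_nbhd b \<Lambda>) \<and> L_shadowing_on f (closed_nbhd b \<Lambda>)"
  shows "UNIV = \<Lambda> \<and> mixing f"
proof -
  obtain g where g: "homeomorphism UNIV UNIV f g"
    using assms(2) by blast
  have gf: "g (f x) = x" and fg: "f (g x) = x" for x
    using g by (auto simp: homeomorphism_def)
  have bij: "bij f"
    using gf fg by (metis bijI')
  have "inv f = g"
    using gf fg by (metis inv_equality)
  then have cont: "continuous_on UNIV f" "continuous_on UNIV (inv f)"
    using g by (auto simp: homeomorphism_def)
  obtain p where p: "p \<in> interior \<Lambda> \<inter> interior (chain_recurrent f)"
    using assms(7) by blast
  \<comment> \<open>Local connectedness supplies a connected neighbourhood of recurrent points, all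
    of which are then chain equivalent.\<close>
  then obtain U where U: "open U" "connected U" "p \<in> U"
    "U \<subseteq> interior \<Lambda> \<inter> interior (chain_recurrent f)"
    using assms(6) unfolding locally_connected_UNIV_iff by (meson open_Int open_interior)
  obtain b where b: "b > 0" "shadowing_on f (closed_nbhd b \<Lambda>)" "L_shadowing_on f (closed_nbhd b \<Lambda>)"
    using assms(8) by blast
  have "U \<subseteq> \<Lambda>" "U \<subseteq> chain_recurrent f"
    using U(4) interior_subset by blast+
  then interpret shadowed_chain_class f \<Lambda> U b p
    using assms(1,3,4) bij cont U(1-3) b
    by unfold_locales (auto simp: invariant_set_def)
  have C: "C = UNIV"
    using C_eq_UNIV[OF assms(5)] .
  then have \<Lambda>: "\<Lambda> = UNIV"
    using C_subset by blast
  have "chain_to f x p" "chain_to f p y" for x y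
    using chain_to_base[of x] C by (auto simp: C_def)
  then have "chain_to f x y" for x y
    using chain_to_trans by metis
  \<comment> \<open>Since \<open>\<Lambda>\<close> is the whole space, so is its
    neighbourhood.\<close>
  moreover have "shadowing_on f UNIV"
    using shadowing \<open>b > 0\<close> \<Lambda> by (simp add: closed_nbhd_def)
  ultimately show ?thesis
    using shadowing_imp_mixing cont assms(5) \<Lambda> by blast
qed

end
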